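(* Let $\ell\geq 5$ be an integer such that both $\ell$ and $\ell-2$ are prime powers. Then there exists an $\left(\ell(\ell-2), \frac{(\ell-1)^2}{2}, \frac{(\ell-1)^2}{4}\right)$-BIBD admitting a $0$-ULSE $\ell$-colouring.
   Context: For positive integers $v,k,\lambda$ with $2\le k<v$, a $(v,k,\lambda)$-BIBD is a pair $(V,\mathcal{B})$ where $V$ is a set of $v$ points and $\mathcal{B}$ is a collection of $k$-element subsets of $V$ (blocks) such that every pair of distinct points lies in exactly $\lambda$ blocks. An $\ell$-colouring of a BIBD is a surjective map from $V$ onto a set of $\ell$ colours. A $0$-ULSE $\ell$-colouring is an $\ell$-colouring such that $(\ell-1)$ divides $k$ and in every block exactly one colour does not appear, while each of the other $\ell-1$ colours appears exactly $\frac{k}{\ell-1}$ times in that block. *)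

theory Defs
  imports "HOL-Library.Multiset" "HOL-Number_Theory.Prime_Powers"
begin

text \<open>
  Blocks form a multiset, as usual in design theory: a design may contain repeated blocks.
\<close>

definition is_BIBD :: "'a set \<Rightarrow> 'a set multiset \<Rightarrow> nat \<Rightarrow> nat \<Rightarrow> nat \<Rightarrow> bool" where
  "is_BIBD V \<B> v k lam \<longleftrightarrow>
     2 \<le> k \<and> k < v \<and> 0 < lam \<and>
     finite V \<and> card V = v \<and>
     (\<forall>b \<in># \<B>. b \<subseteq> V \<and> card b = k) \<and>
     (\<forall>x \<in> V. \<forall>y \<in> V. x \<noteq> y \<longrightarrow> size {#b \<in># \<B>. x \<in> b \<and> y \<in> b#} = lam)"

definition is_colouring :: "'a set \<Rightarrow> nat \<Rightarrow> 'c set \<Rightarrow> ('a \<Rightarrow> 'c) \<Rightarrow> bool" where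
  "is_colouring V l C c \<longleftrightarrow> finite C \<and> card C = l \<and> c ` V = C"

text \<open>
  Here \<open>k\<close> is the block size of the design; \<open>k div (l - 1)\<close> is an exact quotient because of the
  divisibility condition.
\<close>

definition is_0_ULSE_colouring ::
  "'a set \<Rightarrow> 'a set multiset \<Rightarrow> nat \<Rightarrow> nat \<Rightarrow> 'c set \<Rightarrow> ('a \<Rightarrow> 'c) \<Rightarrow> bool" where
  "is_0_ULSE_colouring V \<B> k l C c \<longleftrightarrow>
     is_colouring V l C c \<and> (l - 1) dvd k \<and>
     (\<forall>b \<in># \<B>.
        (\<exists>!q. q \<in> C \<and> q \<notin> c ` b) \<and>
        (\<forall>q \<in> C. q \<in> c ` b \<longrightarrow> card {x \<in> b. c x = q} = k div (l - 1)))"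

end

theory Submission
  imports "HOL-Algebra.Algebraic_Closure" "HOL-Number_Theory.Residues" "HOL-Library.Nat_Bijection" Defs
begin

text \<open>
  The blocks are the translates of the complement of the twin prime power difference set. With
  \<open>q = \<ell> - 2\<close> and quadratic characters \<open>\<chi>\<close>, \<open>\<psi>\<close> of the fields with \<open>q\<close> and \<open>\<ell>\<close> elements, the block with
  index \<open>(g, h)\<close> consists of the points \<open>(x, y)\<close> with \<open>y \<noteq> h\<close> and either \<open>x = g\<close> or
  \<open>\<chi>(x - g) \<psi>(y - h) = -1\<close>. Colour a point by its second coordinate: the block misses
  exactly the colour \<open>h\<close>, and meets every other one in \<open>1 + (q - 1) / 2\<close> points. Twice the indicator of a
  block is \<open>[y \<noteq> h] (1 + [x = g]) - \<chi>(x - g) \<psi>(y - h)\<close>, so counting the blocks through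
  two points reduces to the character sums \<open>\<Sum>\<^sub>z \<chi>(x - z) \<chi>(y - z) = -1\<close>; the remaining cross terms
  cancel because \<open>\<chi>(-1) \<psi>(-1) = -1\<close>, as exactly one of \<open>q\<close>, \<open>q + 2\<close> is \<open>1\<close> modulo \<open>4\<close>.
\<close>

section \<open>Designs from twin Jacobsthal matrices\<close>

text \<open>
  The properties of the matrix \<open>\<chi>(x - y)\<close> that the counting needs, without the field.
\<close>

definition jacobsthal :: "'a set \<Rightarrow> ('a \<Rightarrow> 'a \<Rightarrow> int) \<Rightarrow> bool" where
  "jacobsthal A P \<longleftrightarrow> finite A \<and>
     (\<forall>x\<in>A. P x x = 0) \<and>
     (\<forall>x\<in>A. \<forall>y\<in>A. x \<noteq> y \<longrightarrow> \<bar>P x y\<bar> = 1) \<and>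
     (\<forall>x\<in>A. \<forall>y\<in>A. P y x = (-1) ^ ((card A - 1) div 2) * P x y) \<and>
     (\<forall>x\<in>A. (\<Sum>z\<in>A. P x z) = 0) \<and>
     (\<forall>x\<in>A. \<forall>y\<in>A. x \<noteq> y \<longrightarrow> (\<Sum>z\<in>A. P x z * P y z) = -1)"

lemma jacobsthalD:
  assumes "jacobsthal A P"
  shows "finite A" "\<And>x. x \<in> A \<Longrightarrow> P x x = 0"
    "\<And>x y. x \<in> A \<Longrightarrow> y \<in> A \<Longrightarrow> x \<noteq> y \<Longrightarrow> \<bar>P x y\<bar> = 1"
    "\<And>x y. x \<in> A \<Longrightarrow> y \<in> A \<Longrightarrow> P y x = (-1) ^ ((card A - 1) div 2) * P x y"
    "\<And>x. x \<in> A \<Longrightarrow> (\<Sum>z\<in>A. P x z) = 0"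
    "\<And>x y. x \<in> A \<Longrightarrow> y \<in> A \<Longrightarrow> x \<noteq> y \<Longrightarrow> (\<Sum>z\<in>A. P x z * P y z) = -1"
  using assms unfolding jacobsthal_def by blast+

lemma jacobsthal_column_sum:
  assumes "jacobsthal A P" "x \<in> A"
  shows "(\<Sum>z\<in>A. P z x) = 0"
proof -
  have "(\<Sum>z\<in>A. P z x) = (-1) ^ ((card A - 1) div 2) * (\<Sum>z\<in>A. P x z)"
    unfolding sum_distrib_left using jacobsthalD(4)[OF assms(1,2)] by (intro sum.cong) auto
  then show ?thesis using jacobsthalD(5)[OF assms] by simp
qed

text \<open>The matrix identity \<open>P P^T = q I - J\<close>: on the diagonal each row contributes
  one square 1 for every entry other than its single zero.\<close>

lemma jacobsthal_gram:
  assumes "jacobsthal A P" "x \<in> A" "y \<in> A"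
  shows "(\<Sum>z\<in>A. P x z * P y z) = of_bool (x = y) * int (card A) - 1"
proof (cases "x = y")
  case True
  have *: "P x z * P x z = of_bool (x \<noteq> z)" if "z \<in> A" for z
  proof (cases "x = z")
    case False
    then have "\<bar>P x z * P x z\<bar> = 1"
      using jacobsthalD(3)[OF assms(1,2) that] by (simp add: abs_mult)
    then show ?thesis using False by simp
  qed (use jacobsthalD(2)[OF assms(1,2)] in auto)
  have "(\<Sum>z\<in>A. P x z * P x z) = (\<Sum>z\<in>A. 1 - of_bool (z = x))"
    using * by (intro sum.cong) auto
  also have "\<dots> = int (card A) - 1"
    using assms(2) jacobsthalD(1)[OF assms(1)] by (simp add: sum_subtractf of_bool_def)
  finally show ?thesis using True by simp
qed (use jacobsthalD(6)[OF assms] in simp)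

text \<open>Allows the elements of a finite field to be renamed \<open>0, ..., n - 1\<close>, so
  that both matrices of a twin pair are indexed by naturals.\<close>

lemma jacobsthal_bij_betw:
  assumes "jacobsthal A P" "bij_betw f B A"
  shows "jacobsthal B (\<lambda>x y. P (f x) (f y))"
proof -
  have mem: "f x \<in> A" if "x \<in> B" for x using that assms(2) bij_betwE by blast
  have inj: "f x \<noteq> f y" if "x \<in> B" "y \<in> B" "x \<noteq> y" for x y
    using that assms(2) unfolding bij_betw_def inj_on_def by blast
  have fin: "finite B" using assms(2) jacobsthalD(1)[OF assms(1)] bij_betw_finite by blast
  have card: "card B = card A" using assms(2) by (rule bij_betw_same_card)
  have row: "(\<Sum>z\<in>B. P u (f z)) = (\<Sum>z\<in>A. P u z)" for u
    by (rule sum.reindex_bij_betw[OF assms(2)])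
  have gram: "(\<Sum>z\<in>B. P u (f z) * P v (f z)) = (\<Sum>z\<in>A. P u z * P v z)" for u v
    by (rule sum.reindex_bij_betw[OF assms(2), of "\<lambda>z. P u z * P v z"])
  show ?thesis
    unfolding jacobsthal_def row gram card
  proof (intro conjI ballI impI)
    fix x y assume "x \<in> B" "y \<in> B"
    then show "P (f y) (f x) = (-1) ^ ((card A - 1) div 2) * P (f x) (f y)"
      using jacobsthalD(4)[OF assms(1) mem mem] by blast
  qed (use fin jacobsthalD(2,3,5,6)[OF assms(1)] mem inj in auto)
qed

section \<open>Counting blocks and colours for a twin pair of matrices\<close>

locale twin_jacobsthal =
  fixes A :: "'a set" and B :: "'b set" and P :: "'a \<Rightarrow> 'a \<Rightarrow> int" and Q :: "'b \<Rightarrow> 'b \<Rightarrow> int"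
  assumes P: "jacobsthal A P" and Q: "jacobsthal B Q"
    and card_B: "card B = card A + 2" and odd_A: "odd (card A)"
begin

definition block :: "'a \<times> 'b \<Rightarrow> ('a \<times> 'b) set" where
  "block gh = {(x, y). x \<in> A \<and> y \<in> B \<and> y \<noteq> snd gh \<and> (x = fst gh \<or> P x (fst gh) * Q y (snd gh) = -1)}"

definition weight :: "'a \<Rightarrow> 'b \<Rightarrow> 'a \<Rightarrow> 'b \<Rightarrow> int" where
  "weight x y g h = of_bool (y \<noteq> h) * (1 + of_bool (x = g)) - P x g * Q y h"

lemma finite_A: "finite A" and finite_B: "finite B"
  using jacobsthalD(1) P Q by auto

text \<open>For \<open>x \<noteq> g\<close> and \<open>y \<noteq> h\<close> the product of entries
  is 1 or -1, so one minus it is 0 or 2. For \<open>x = g\<close> the product vanishes and the extra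
  summand 1 gives 2; for \<open>y = h\<close> everything vanishes.\<close>

lemma weight_eq:
  assumes "x \<in> A" "g \<in> A" "y \<in> B" "h \<in> B"
  shows "weight x y g h = 2 * of_bool ((x, y) \<in> block (g, h))"
proof -
  have "y = h \<Longrightarrow> Q y h = 0" "x = g \<Longrightarrow> P x g = 0"
    using jacobsthalD(2)[OF P] jacobsthalD(2)[OF Q] assms by auto
  moreover have "P x g * Q y h = 1 \<or> P x g * Q y h = -1" if "x \<noteq> g" "y \<noteq> h"
  proof -
    have "\<bar>P x g * Q y h\<bar> = 1"
      using jacobsthalD(3)[OF P, of x g] jacobsthalD(3)[OF Q, of y h] assms that
      by (simp add: abs_mult)
    then show ?thesis by linarith
  qed
  ultimately show ?thesis
    using assms unfolding weight_def block_def by (auto simp: of_bool_def)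
qed

text \<open>With \<open>card A = 2 * m + 1\<close> the symmetry signs of \<open>P\<close> and
  \<open>Q\<close> are \<open>(-1) ^ m\<close> and \<open>(-1) ^ (m + 1)\<close>: one matrix is
  symmetric and the other skew.\<close>

lemma antisymmetric:
  assumes "x \<in> A" "x' \<in> A" "y \<in> B" "y' \<in> B"
  shows "P x' x * Q y' y = - (P x x' * Q y y')"
proof -
  obtain m where m: "card A = 2 * m + 1" using odd_A by (rule oddE)
  have "P x' x * Q y' y = (-1) ^ m * (-1) ^ (m + 1) * (P x x' * Q y y')"
    using jacobsthalD(4)[OF P assms(1,2)] jacobsthalD(4)[OF Q assms(3,4)]
    by (simp add: m card_B)
  also have "(-1) ^ m * (-1) ^ (m + 1) = (-1 :: int)"
    by (simp flip: power_add mult_2)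
  finally show ?thesis by simp
qed

text \<open>Each weight is a difference of two products of a function of \<open>g\<close> and a
  function of \<open>h\<close>. Multiplying out therefore gives four double sums, each of which
  factors into a sum over \<open>A\<close> times a sum over \<open>B\<close>.\<close>

lemma sum_weight_mult_weight:
  assumes "x \<in> A" "x' \<in> A" "y \<in> B" "y' \<in> B" "(x, y) \<noteq> (x', y')"
  shows "(\<Sum>g\<in>A. \<Sum>h\<in>B. weight x y g h * weight x' y' g h) = (int (card A) + 1)\<^sup>2"
proof -
  define q where "q = int (card A)"
  define e where "e y h = (of_bool (y \<noteq> h) :: int)" for y h :: 'b
  define d where "d x g = (1 + of_bool (x = g) :: int)" for x g :: 'a
  have ee: "(\<Sum>h\<in>B. e y h * e y' h) = q + of_bool (y = y')"
  proof -
    have "(\<Sum>h\<in>B. e y h * e y' h)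
      = (\<Sum>h\<in>B. 1 - of_bool (h = y) - of_bool (h = y') + of_bool (y = y') * of_bool (h = y))"
      unfolding e_def by (intro sum.cong) (auto simp: of_bool_def)
    also have "\<dots> = q + of_bool (y = y')"
      using assms finite_B card_B
      by (simp add: q_def sum.distrib sum_subtractf of_bool_def flip: sum_distrib_left)
    finally show ?thesis .
  qed
  have dd: "(\<Sum>g\<in>A. d x g * d x' g) = q + 2 + of_bool (x = x')"
  proof -
    have "(\<Sum>g\<in>A. d x g * d x' g)
      = (\<Sum>g\<in>A. 1 + of_bool (g = x) + of_bool (g = x') + of_bool (x = x') * of_bool (g = x))"
      unfolding d_def by (intro sum.cong) (auto simp: of_bool_def)
    also have "\<dots> = q + 2 + of_bool (x = x')"
      using assms finite_A by (simp add: q_def sum.distrib of_bool_def flip: sum_distrib_left)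
    finally show ?thesis .
  qed
  \<comment> \<open>Rows sum to 0. The factor \<open>e\<close> deletes column \<open>u\<close>,
    leaving \<open>- Q v u\<close>; the factor \<open>d\<close> below counts column \<open>u\<close>
    twice, leaving \<open>P v u\<close>.\<close>
  have eQ: "(\<Sum>h\<in>B. e u h * Q v h) = - Q v u" if "u \<in> B" "v \<in> B" for u v
  proof -
    have "(\<Sum>h\<in>B. e u h * Q v h) = (\<Sum>h\<in>B. Q v h - (if h = u then Q v u else 0))"
      unfolding e_def by (intro sum.cong) auto
    then show ?thesis using that finite_B jacobsthalD(5)[OF Q] by (simp add: sum_subtractf)
  qed
  have dP: "(\<Sum>g\<in>A. d u g * P v g) = P v u" if "u \<in> A" "v \<in> A" for u v
  proof -
    have "(\<Sum>g\<in>A. d u g * P v g) = (\<Sum>g\<in>A. P v g + (if g = u then P v u else 0))"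
      unfolding d_def by (intro sum.cong) auto
    then show ?thesis using that finite_A jacobsthalD(5)[OF P] by (simp add: sum.distrib)
  qed
  have "(\<Sum>g\<in>A. \<Sum>h\<in>B. weight x y g h * weight x' y' g h)
    = (\<Sum>g\<in>A. \<Sum>h\<in>B. (d x g * d x' g) * (e y h * e y' h) - (d x g * P x' g) * (e y h * Q y' h)
        - (d x' g * P x g) * (e y' h * Q y h) + (P x g * P x' g) * (Q y h * Q y' h))"
    unfolding weight_def by (intro sum.cong) (auto simp: d_def e_def algebra_simps)
  also have "\<dots> = (\<Sum>g\<in>A. d x g * d x' g) * (\<Sum>h\<in>B. e y h * e y' h)
      - (\<Sum>g\<in>A. d x g * P x' g) * (\<Sum>h\<in>B. e y h * Q y' h)
      - (\<Sum>g\<in>A. d x' g * P x g) * (\<Sum>h\<in>B. e y' h * Q y h)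
      + (\<Sum>g\<in>A. P x g * P x' g) * (\<Sum>h\<in>B. Q y h * Q y' h)"
    unfolding sum_product by (simp only: sum.distrib sum_subtractf)
  also have "\<dots> = (q + 2 + of_bool (x = x')) * (q + of_bool (y = y')) 
      + P x' x * Q y' y + P x x' * Q y y'
      + (of_bool (x = x') * q - 1) * (of_bool (y = y') * (q + 2) - 1)"
    using assms card_B
    by (simp add: ee dd eQ dP jacobsthal_gram[OF P] jacobsthal_gram[OF Q] flip: q_def)
  \<comment> \<open>The two mixed terms cancel by \<open>antisymmetric\<close>. What is left is
    \<open>(q + 2) * q + 1\<close>, \<open>(q + 3) * q - (q - 1)\<close> or
    \<open>(q + 2) * (q + 1) - (q + 1)\<close>, according to which coordinates agree; all three are
    the same square.\<close>
  also have "\<dots> = (q + 1)\<^sup>2"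
    using assms(5) antisymmetric[OF assms(1-4)]
    by (cases "x = x'"; cases "y = y'") (simp_all add: power2_eq_square algebra_simps)
  finally show ?thesis unfolding q_def .
qed

text \<open>A product of two weights is 4 times the indicator that both points lie in the block.
  Keeping the factor 4 on the left avoids a division.\<close>

lemma card_blocks_containing:
  assumes "p \<in> A \<times> B" "p' \<in> A \<times> B" "p \<noteq> p'"
  shows "4 * card {gh \<in> A \<times> B. p \<in> block gh \<and> p' \<in> block gh} = (card A + 1)\<^sup>2"
proof -
  obtain x y x' y' where p: "p = (x, y)" "p' = (x', y')" by fastforce
  have "4 * int (card {gh \<in> A \<times> B. p \<in> block gh \<and> p' \<in> block gh})
    = 4 * (\<Sum>gh\<in>A \<times> B. of_bool (p \<in> block gh \<and> p' \<in> block gh))"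
    using finite_A finite_B by (simp add: Int_def)
  also have "\<dots> = (\<Sum>(g, h)\<in>A \<times> B. weight x y g h * weight x' y' g h)"
    unfolding sum_distrib_left using assms by (intro sum.cong) (auto simp: p weight_eq)
  also have "\<dots> = (\<Sum>g\<in>A. \<Sum>h\<in>B. weight x y g h * weight x' y' g h)"
    by (simp add: sum.cartesian_product)
  also have "\<dots> = (int (card A) + 1)\<^sup>2"
    using assms by (intro sum_weight_mult_weight) (auto simp: p)
  finally have "int (4 * card {gh \<in> A \<times> B. p \<in> block gh \<and> p' \<in> block gh}) = int ((card A + 1)\<^sup>2)"
    by simp
  then show ?thesis by (simp only: of_nat_eq_iff)
qed

text \<open>Sum the weights over the points of one colour: the term with \<open>P\<close> disappears
  because columns of \<open>P\<close> sum to 0, and \<open>x = g\<close> is counted one extra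
  time.\<close>

lemma card_block_colour:
  assumes "g \<in> A" "h \<in> B" "y \<in> B" "y \<noteq> h"
  shows "2 * card {p \<in> block (g, h). snd p = y} = card A + 1"
proof -
  have "{p \<in> block (g, h). snd p = y} = (\<lambda>x. (x, y)) ` {x \<in> A. (x, y) \<in> block (g, h)}"
    unfolding block_def by auto
  then have "card {p \<in> block (g, h). snd p = y} = card {x \<in> A. (x, y) \<in> block (g, h)}"
    by (simp add: card_image inj_on_def)
  then have "2 * int (card {p \<in> block (g, h). snd p = y})
    = 2 * (\<Sum>x\<in>A. of_bool ((x, y) \<in> block (g, h)))"
    using finite_A by (simp add: Int_def)
  also have "\<dots> = (\<Sum>x\<in>A. weight x y g h)"
    unfolding sum_distrib_left using assms by (intro sum.cong) (auto simp: weight_eq)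
  also have "\<dots> = (\<Sum>x\<in>A. 1 + of_bool (x = g) - P x g * Q y h)"
    using assms(4) by (simp add: weight_def)
  also have "\<dots> = int (card A) + 1"
    using assms(1) finite_A jacobsthal_column_sum[OF P assms(1)]
    by (simp add: sum.distrib sum_subtractf of_bool_def flip: sum_distrib_right)
  finally have "int (2 * card {p \<in> block (g, h). snd p = y}) = int (card A + 1)" by simp
  then show ?thesis by (simp only: of_nat_eq_iff)
qed

lemma snd_block:
  assumes "g \<in> A" "h \<in> B"
  shows "snd ` block (g, h) = B - {h}"
proof -
  \<comment> \<open>The clause \<open>x = fst gh\<close> in \<open>block\<close> supplies a point of
    every colour other than \<open>h\<close>.\<close>
  have "(g, y) \<in> block (g, h)" if "y \<in> B - {h}" for y
    using that assms unfolding block_def by auto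
  then show ?thesis unfolding block_def by force
qed

lemma block_subset: "block gh \<subseteq> A \<times> B"
  unfolding block_def by auto

lemma card_block:
  assumes "g \<in> A" "h \<in> B"
  shows "2 * card (block (g, h)) = (card A + 1)\<^sup>2"
proof -
  have fin: "finite (block (g, h))"
    using finite_subset[OF block_subset] finite_A finite_B by blast
  have "card (block (g, h)) = (\<Sum>y\<in>B - {h}. card {p \<in> block (g, h). snd p = y})"
    unfolding card_eq_sum using sum.image_gen[OF fin, of "\<lambda>_. 1" snd]
    by (simp only: snd_block[OF assms])
  then have "2 * card (block (g, h)) = (\<Sum>y\<in>B - {h}. card A + 1)"
    using card_block_colour[OF assms] by (simp add: sum_distrib_left)
  also have "\<dots> = (card A + 1)\<^sup>2"
    using assms finite_B card_B by (simp add: power2_eq_square)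
  finally show ?thesis .
qed

end

text \<open>Points are coded as naturals by \<open>prod_encode\<close> and coloured by their second
  coordinate. The blocks are the image of a multiset of indices, so a repeated block keeps its
  multiplicity and counting blocks amounts to counting indices.\<close>

lemma twin_jacobsthal_design:
  fixes A B :: "nat set"
  assumes "twin_jacobsthal A B P Q" and l: "card B = l" "5 \<le> l"
  shows "\<exists>(V :: nat set) (\<B> :: nat set multiset) (C :: nat set) (c :: nat \<Rightarrow> nat).
           is_BIBD V \<B> (l * (l - 2)) ((l - 1)\<^sup>2 div 2) ((l - 1)\<^sup>2 div 4) \<and>
           is_0_ULSE_colouring V \<B> ((l - 1)\<^sup>2 div 2) l C c"
proof -
  interpret twin_jacobsthal A B P Q by fact
  define V where "V = prod_encode ` (A \<times> B)"
  define \<B> where "\<B> = image_mset (\<lambda>gh. prod_encode ` block gh) (mset_set (A \<times> B))"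
  define c where "c = snd \<circ> prod_decode"
  have card_A: "card A = l - 2" using card_B l by simp
  \<comment> \<open>Oddness of \<open>l\<close> makes all divisions exact: block size
    \<open>2 * m^2\<close>, index \<open>m^2\<close>, and \<open>m\<close> points of each colour
    that occurs in a block.\<close>
  obtain m where m: "l = 2 * m + 1" using odd_A card_B l(1) by (metis even_add even_numeral oddE)
  have m2: "m \<ge> 2" using m l(2) by simp
  have sq: "(l - 1)\<^sup>2 = 4 * m\<^sup>2" by (simp add: m power_mult_distrib)
  have sq': "(card A + 1)\<^sup>2 = (l - 1)\<^sup>2" using card_A l(2) by simp
  have k: "(l - 1)\<^sup>2 div 2 = 2 * m\<^sup>2" and lam: "(l - 1)\<^sup>2 div 4 = m\<^sup>2" unfolding sq by simp_all
  have inj: "inj_on prod_encode S" for S by (rule inj_prod_encode)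
  have fin: "finite (A \<times> B)" using finite_A finite_B by simp
  have blockE: "\<exists>g\<in>A. \<exists>h\<in>B. b = prod_encode ` block (g, h)" if "b \<in># \<B>" for b
    using that fin unfolding \<B>_def by auto
  have enc_iff: "prod_encode p \<in> prod_encode ` S \<longleftrightarrow> p \<in> S" for p S
    by (rule inj_image_mem_iff[OF inj])
  have "is_BIBD V \<B> (l * (l - 2)) ((l - 1)\<^sup>2 div 2) ((l - 1)\<^sup>2 div 4)"
    unfolding is_BIBD_def
  proof (intro conjI ballI impI)
    show "2 \<le> (l - 1)\<^sup>2 div 2" "0 < (l - 1)\<^sup>2 div 4"
      unfolding k lam using m2 by (simp_all add: power2_eq_square trans_le_add1)
    show "(l - 1)\<^sup>2 div 2 < l * (l - 2)"
    proof -
      \<comment> \<open>The shift removes the truncated subtraction: the claim becomes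
        \<open>2 * (n + 2)^2 < (2 * n + 5) * (2 * n + 3)\<close>, which holds coefficient by
        coefficient.\<close>
      obtain n where n: "m = n + 2" using m2 le_iff_add by (metis add.commute)
      show ?thesis unfolding k by (simp add: m n power2_eq_square algebra_simps)
    qed
    show "finite V" unfolding V_def using fin by simp
    show "card V = l * (l - 2)"
      unfolding V_def card_image[OF inj] card_cartesian_product card_A l(1) by simp
  next
    fix b assume "b \<in># \<B>"
    then obtain g h where gh: "g \<in> A" "h \<in> B" "b = prod_encode ` block (g, h)" using blockE by blast
    show "b \<subseteq> V" unfolding gh V_def using block_subset by blast
    show "card b = (l - 1)\<^sup>2 div 2"
      unfolding gh(3) card_image[OF inj] using card_block[OF gh(1,2)] sq' by simp
  next
    fix p p' assume "p \<in> V" "p' \<in> V" "p \<noteq> p'"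
    then obtain r r' where r: "r \<in> A \<times> B" "r' \<in> A \<times> B" "p = prod_encode r" "p' = prod_encode r'" "r \<noteq> r'"
      unfolding V_def by blast
    have "size {#b \<in># \<B>. p \<in> b \<and> p' \<in> b#} = card {gh \<in> A \<times> B. r \<in> block gh \<and> r' \<in> block gh}"
      unfolding \<B>_def r(3,4) using fin by (simp add: filter_mset_image_mset enc_iff)
    then show "size {#b \<in># \<B>. p \<in> b \<and> p' \<in> b#} = (l - 1)\<^sup>2 div 4"
      using card_blocks_containing[OF r(1,2,5)] sq' by simp
  qed
  moreover have "is_0_ULSE_colouring V \<B> ((l - 1)\<^sup>2 div 2) l B c"
    unfolding is_0_ULSE_colouring_def is_colouring_def
  proof (intro conjI ballI impI)
    show "finite B" "card B = l" by (fact finite_B, fact l(1))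
    have "A \<noteq> {}" using odd_A by auto
    then show "c ` V = B" unfolding c_def V_def by (auto simp: image_image)
    show "l - 1 dvd (l - 1)\<^sup>2 div 2" unfolding k by (simp add: m power2_eq_square)
  next
    fix b assume "b \<in># \<B>"
    then obtain g h where gh: "g \<in> A" "h \<in> B" "b = prod_encode ` block (g, h)" using blockE by blast
    have cb: "c ` b = B - {h}"
      using snd_block[OF gh(1,2)] by (simp add: gh(3) c_def image_image)
    show "\<exists>!q. q \<in> B \<and> q \<notin> c ` b" unfolding cb using gh(2) by blast
    fix y assume y: "y \<in> B" "y \<in> c ` b"
    have "{x \<in> b. c x = y} = prod_encode ` {p \<in> block (g, h). snd p = y}"
      unfolding gh(3) c_def by auto
    then have "card {x \<in> b. c x = y} = card {p \<in> block (g, h). snd p = y}"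
      by (simp add: card_image[OF inj])
    moreover have "2 * card {p \<in> block (g, h). snd p = y} = card A + 1"
      using y cb by (intro card_block_colour gh) auto
    ultimately have "card {x \<in> b. c x = y} = m" using card_A m l(2) by simp
    also have "m = (l - 1)\<^sup>2 div 2 div (l - 1)" unfolding k using m2 by (simp add: m power2_eq_square)
    finally show "card {x \<in> b. c x = y} = (l - 1)\<^sup>2 div 2 div (l - 1)" .
  qed
  ultimately show ?thesis by blast
qed

section \<open>Finite fields of prime power order\<close>

lemma (in cring) binomial_theorem:
  assumes a: "a \<in> carrier R" and b: "b \<in> carrier R"
  shows "(a \<oplus> b) [^] (n :: nat) = (\<Oplus>i\<in>{..n}. [(n choose i)] \<cdot> (a [^] i \<otimes> b [^] (n - i)))"
proof (induction n)
  case 0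
  show ?case using a b by simp
next
  case (Suc n)
  let ?t = "\<lambda>m i :: nat. a [^] i \<otimes> b [^] (m - i)"
  have t: "?t m i \<in> carrier R" for m i using a b by simp
  \<comment> \<open>Split off index 0 and apply Pascal's rule to the rest. The sum with
    \<open>n choose Suc i\<close> takes index 0 back, loses its top term
    \<open>n choose Suc n\<close>, and becomes \<open>b\<close> times the expansion for
    \<open>n\<close>; the other sum is \<open>a\<close> times it.\<close>
  have "(\<Oplus>i\<in>{..Suc n}. [(Suc n choose i)] \<cdot> ?t (Suc n) i)
    = (\<Oplus>i\<in>{..n}. [(n choose i)] \<cdot> ?t (Suc n) (Suc i) \<oplus> [(n choose Suc i)] \<cdot> ?t (Suc n) (Suc i))
        \<oplus> [(n choose 0)] \<cdot> ?t (Suc n) 0"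
    using a b by (subst finsum_Suc2) (auto simp: add.nat_pow_mult)
  also have "\<dots> = (\<Oplus>i\<in>{..n}. [(n choose i)] \<cdot> ?t (Suc n) (Suc i))
        \<oplus> ((\<Oplus>i\<in>{..n}. [(n choose Suc i)] \<cdot> ?t (Suc n) (Suc i)) \<oplus> [(n choose 0)] \<cdot> ?t (Suc n) 0)"
    using a b by (subst finsum_addf) (auto simp: a_assoc)
  also have "(\<Oplus>i\<in>{..n}. [(n choose Suc i)] \<cdot> ?t (Suc n) (Suc i)) \<oplus> [(n choose 0)] \<cdot> ?t (Suc n) 0
    = (\<Oplus>i\<in>{..Suc n}. [(n choose i)] \<cdot> ?t (Suc n) i)"
    using a b by (subst finsum_Suc2) auto
  also have "\<dots> = (\<Oplus>i\<in>{..n}. [(n choose i)] \<cdot> ?t (Suc n) i)"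
    using a b by (subst finsum_Suc) (auto simp: binomial_eq_0)
  also have "\<dots> = b \<otimes> (\<Oplus>i\<in>{..n}. [(n choose i)] \<cdot> ?t n i)"
  proof -
    have "b \<otimes> [k] \<cdot> ?t n i = [k] \<cdot> ?t (Suc n) i" if "i \<le> n" for i and k :: nat
      using a b that by (simp add: add_pow_rdistr Suc_diff_le m_ac)
    then show ?thesis using a b by (subst finsum_rdistr) (auto intro!: finsum_cong')
  qed
  also have "(\<Oplus>i\<in>{..n}. [(n choose i)] \<cdot> ?t (Suc n) (Suc i)) = a \<otimes> (\<Oplus>i\<in>{..n}. [(n choose i)] \<cdot> ?t n i)"
  proof -
    have "a \<otimes> [k] \<cdot> ?t n i = [k] \<cdot> ?t (Suc n) (Suc i)" for i and k :: nat
      using a b by (simp add: add_pow_rdistr m_ac)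
    then show ?thesis using a b by (subst finsum_rdistr) (auto intro!: finsum_cong')
  qed
  also have "a \<otimes> (\<Oplus>i\<in>{..n}. [(n choose i)] \<cdot> ?t n i) \<oplus> b \<otimes> (\<Oplus>i\<in>{..n}. [(n choose i)] \<cdot> ?t n i)
    = (a \<oplus> b) [^] Suc n"
    unfolding Suc.IH[symmetric] using a b by (simp add: l_distr m_comm)
  finally show ?case by simp
qed

lemma (in cring) add_pow_eq_zero:
  fixes p :: nat
  assumes "[p] \<cdot> \<one> = \<zero>" "p dvd n" "x \<in> carrier R"
  shows "[n] \<cdot> x = \<zero>"
proof -
  obtain m where n: "n = p * m" using assms(2) by (rule dvdE)
  have "[p] \<cdot> x = ([p] \<cdot> \<one>) \<otimes> x" using assms(3) by (simp add: add_pow_ldistr)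
  then have "[p] \<cdot> x = \<zero>" using assms(1,3) by simp
  then show ?thesis using add.nat_pow_pow[OF assms(3), of m p] by (simp add: n)
qed

lemma (in cring) frobenius_add:
  fixes p :: nat
  assumes "prime p" "[p] \<cdot> \<one> = \<zero>" and a: "a \<in> carrier R" and b: "b \<in> carrier R"
  shows "(a \<oplus> b) [^] p = a [^] p \<oplus> b [^] p"
proof -
  \<comment> \<open>Since \<open>p\<close> is at least 2, the indices 0 and \<open>p\<close> are
    distinct and can both be peeled off. The prime \<open>p\<close> divides every coefficient in
    between.\<close>
  obtain r where r: "p = Suc (Suc r)"
    using prime_ge_2_nat[OF assms(1)] by (metis Suc_1 add_2_eq_Suc le_Suc_ex)
  have zero: "[(p choose Suc i)] \<cdot> (a [^] Suc i \<otimes> b [^] (p - Suc i)) = \<zero>" if "i \<le> r" for i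
  proof (rule add_pow_eq_zero[OF assms(2)])
    show "p dvd p choose Suc i" using assms(1) that by (intro dvd_choose_prime) (auto simp: r)
  qed (use a b in simp)
  have "(a \<oplus> b) [^] p = (\<Oplus>i\<in>{..Suc (Suc r)}. [(p choose i)] \<cdot> (a [^] i \<otimes> b [^] (p - i)))"
    using binomial_theorem[OF a b, of p] by (simp only: r)
  also have "\<dots> = [(p choose p)] \<cdot> (a [^] p \<otimes> b [^] (p - p))
      \<oplus> ((\<Oplus>i\<in>{..r}. [(p choose Suc i)] \<cdot> (a [^] Suc i \<otimes> b [^] (p - Suc i)))
        \<oplus> [(p choose 0)] \<cdot> (a [^] (0 :: nat) \<otimes> b [^] (p - 0)))"
    using a b by (subst finsum_Suc, simp, subst finsum_Suc2, simp) (simp only: r)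
  also have "(\<Oplus>i\<in>{..r}. [(p choose Suc i)] \<cdot> (a [^] Suc i \<otimes> b [^] (p - Suc i))) = \<zero>"
    using zero by (intro add.finprod_one_eqI) auto
  finally show ?thesis using a b by simp
qed

lemma (in cring) frobenius_pow_add:
  fixes p :: nat
  assumes "prime p" "[p] \<cdot> \<one> = \<zero>" "a \<in> carrier R" "b \<in> carrier R"
  shows "(a \<oplus> b) [^] (p ^ k) = a [^] (p ^ k) \<oplus> b [^] (p ^ k)"
proof (induction k)
  case (Suc k)
  have "(a \<oplus> b) [^] (p ^ Suc k) = ((a \<oplus> b) [^] (p ^ k)) [^] p"
    using assms by (simp add: nat_pow_pow mult.commute)
  also have "\<dots> = (a [^] (p ^ k)) [^] p \<oplus> (b [^] (p ^ k)) [^] p"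
    using frobenius_add[OF assms(1,2)] assms Suc by simp
  also have "\<dots> = a [^] (p ^ Suc k) \<oplus> b [^] (p ^ Suc k)"
    using assms by (simp add: nat_pow_pow mult.commute)
  finally show ?case .
qed (use assms in simp)

lemma (in ring_hom_ring) hom_add_pow_one: "h ([(n :: nat)] \<cdot>\<^bsub>R\<^esub> \<one>\<^bsub>R\<^esub>) = [n] \<cdot>\<^bsub>S\<^esub> \<one>\<^bsub>S\<^esub>"
  by (induction n) simp_all

section \<open>The roots of X^q - X in an algebraically closed field of characteristic p\<close>

locale algebraically_closed_prime_char = algebraically_closed +
  fixes p k :: nat
  assumes p: "prime p" "[p] \<cdot> \<one> = \<zero>" and k: "0 < k"
begin

abbreviation "q \<equiv> p ^ k"
abbreviation "LX \<equiv> poly_ring L"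

lemma q_ge_2: "2 \<le> q"
proof -
  have "2 \<le> p" by (rule prime_ge_2_nat[OF p(1)])
  also have "p \<le> q" using \<open>2 \<le> p\<close> k by (intro self_le_power) auto
  finally show ?thesis .
qed

interpretation UP: domain LX
  by (rule univ_poly_is_domain[OF carrier_is_subring])

lemma poly_of_const_hom: "ring_hom_ring L LX poly_of_const"
  using canonical_embedding_ring_hom[OF carrier_is_subring] by simp

interpretation const: ring_hom_cring L LX poly_of_const
  by (intro ring_hom_cring.intro ring_hom_cring_axioms.intro UP.is_cring is_cring
        ring_hom_ring.homh[OF poly_of_const_hom])

lemma UP_char: "[p] \<cdot>\<^bsub>LX\<^esub> \<one>\<^bsub>LX\<^esub> = \<zero>\<^bsub>LX\<^esub>"
  using const.ring.hom_add_pow_one[of p] by (simp add: p)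

text \<open>Its roots in \<open>L\<close> will form the field with \<open>q\<close>
  elements.\<close>

definition fermat_poly :: "'a list" where
  "fermat_poly = X [^]\<^bsub>LX\<^esub> q \<ominus>\<^bsub>LX\<^esub> X"

lemma X_closed: "X \<in> carrier LX"
  by (rule var_closed(1)[OF carrier_is_subring])

lemma fermat_poly_closed: "fermat_poly \<in> carrier LX"
  unfolding fermat_poly_def using X_closed by simp

lemma degree_fermat_poly: "degree fermat_poly = q"
proof -
  have X: "X [^]\<^bsub>LX\<^esub> q = monom \<one> q"
    by (rule unitary_monom_eq_var_pow[OF carrier_is_subring, symmetric])
  have neg: "\<ominus>\<^bsub>LX\<^esub> X = map (\<lambda>a. \<ominus> a) X"
    by (rule univ_poly_a_inv_def'[OF carrier_is_subring X_closed])
  have "polynomial (carrier L) (X [^]\<^bsub>LX\<^esub> q)" "polynomial (carrier L) (\<ominus>\<^bsub>LX\<^esub> X)"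
    using X_closed by (simp_all add: univ_poly_carrier)
  moreover have "degree (X [^]\<^bsub>LX\<^esub> q) = q" unfolding X by (simp add: monom_def)
  moreover have "degree (\<ominus>\<^bsub>LX\<^esub> X) = 1" unfolding neg by (simp add: var_def)
  ultimately show ?thesis
    unfolding fermat_poly_def a_minus_def univ_poly_add
    using q_ge_2 k by (subst poly_add_degree_eq[OF carrier_is_subring]) auto
qed

lemma eval_fermat_poly:
  assumes "a \<in> carrier L"
  shows "eval fermat_poly a = a [^] q \<ominus> a"
proof -
  interpret ev: ring_hom_cring LX L "\<lambda>f. eval f a"
    by (rule eval_cring_hom[OF carrier_is_subring assms])
  show ?thesis
    using assms X_closed by (simp add: fermat_poly_def a_minus_def ev.ring.hom_nat_pow eval_var)
qed

lemma is_root_fermat_poly: "is_root fermat_poly a \<longleftrightarrow> a \<in> carrier L \<and> a [^] q = a"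
proof -
  have "fermat_poly \<noteq> []" using q_ge_2 unfolding degree_fermat_poly[symmetric] by auto
  then show ?thesis unfolding is_root_def using eval_fermat_poly by auto
qed

text \<open>
  With \<open>Y = X - a\<close> and \<open>a\<^sup>q = a\<close>, the Frobenius map turns \<open>X\<^sup>q - X\<close> into \<open>Y\<^sup>q - Y\<close>, which
  is not divisible by \<open>Y\<^sup>2\<close>.
\<close>

lemma alg_mult_fermat_poly: "alg_mult fermat_poly a \<le> 1"
proof (rule ccontr)
  assume mult: "\<not> alg_mult fermat_poly a \<le> 1"
  then have a: "a \<in> carrier L" "a [^] q = a"
    using alg_mult_gt_zero_iff_is_root[OF fermat_poly_closed, of a] is_root_fermat_poly[of a] by auto
  define Y where "Y = X \<ominus>\<^bsub>LX\<^esub> poly_of_const a"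
  have c: "poly_of_const a \<in> carrier LX" using a by simp
  have Y: "Y \<in> carrier LX" unfolding Y_def using X_closed c by simp
  \<comment> \<open>Multiplicities of roots refer to the coefficient list of the linear factor. The
    case \<open>a = \<zero>\<close> is separate because the constant polynomial 0 is the empty
    list.\<close>
  have Y_eq: "[\<one>, \<ominus> a] = Y"
  proof (cases "a = \<zero>")
    case True
    then have "Y = X" unfolding Y_def using X_closed by (simp add: a_minus_def)
    then show ?thesis by (simp add: True var_def)
  next
    case False
    then show ?thesis
      unfolding Y_def a_minus_def univ_poly_a_inv_def'[OF carrier_is_subring c] univ_poly_add
      using a by (simp add: var_def poly_of_const_def)
  qed
  have X: "X = Y \<oplus>\<^bsub>LX\<^esub> poly_of_const a"
    unfolding Y_def using X_closed c by algebra
  have "poly_of_const a [^]\<^bsub>LX\<^esub> q = poly_of_const (a [^] q)"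
    using const.ring.hom_nat_pow[OF a(1), of q] by (rule sym)
  then have "X [^]\<^bsub>LX\<^esub> q = Y [^]\<^bsub>LX\<^esub> q \<oplus>\<^bsub>LX\<^esub> poly_of_const a"
    using UP.frobenius_pow_add[OF p(1) UP_char Y c, of k] a(2) X by simp
  then have f: "fermat_poly = Y [^]\<^bsub>LX\<^esub> q \<ominus>\<^bsub>LX\<^esub> Y"
  proof -
    have "(u \<oplus>\<^bsub>LX\<^esub> poly_of_const a) \<ominus>\<^bsub>LX\<^esub> X = u \<ominus>\<^bsub>LX\<^esub> Y" if "u \<in> carrier LX" for u
      unfolding X using Y c that by algebra
    then show ?thesis
      unfolding fermat_poly_def \<open>X [^]\<^bsub>LX\<^esub> q = _\<close> using Y by simp
  qed
  have "Y [^]\<^bsub>LX\<^esub> (2 :: nat) pdivides fermat_poly"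
    using le_alg_mult_imp_pdivides[OF a(1) fermat_poly_closed, of 2] mult by (simp add: Y_eq)
  then obtain r where r: "r \<in> carrier LX" "fermat_poly = Y [^]\<^bsub>LX\<^esub> (2 :: nat) \<otimes>\<^bsub>LX\<^esub> r"
    unfolding pdivides_def by blast
  obtain m where m: "q = 2 + m" using q_ge_2 le_Suc_ex by blast
  \<comment> \<open>From \<open>Y^q - Y = Y^2 r\<close> and \<open>q = 2 + m\<close> it follows that
    \<open>Y = Y^2 s\<close>. Cancelling one \<open>Y\<close> and evaluating at \<open>a\<close>,
    where \<open>Y\<close> vanishes, gives 1 = 0.\<close>
  define s where "s = Y [^]\<^bsub>LX\<^esub> m \<ominus>\<^bsub>LX\<^esub> r"
  have s: "s \<in> carrier LX" unfolding s_def using Y r by simp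
  have sq: "Y [^]\<^bsub>LX\<^esub> (2 :: nat) = Y \<otimes>\<^bsub>LX\<^esub> Y"
    using Y by (simp add: numeral_2_eq_2)
  have "Y [^]\<^bsub>LX\<^esub> q = Y \<otimes>\<^bsub>LX\<^esub> Y \<otimes>\<^bsub>LX\<^esub> Y [^]\<^bsub>LX\<^esub> m"
    unfolding m using UP.nat_pow_mult[OF Y, of 2 m] by (simp add: sq)
  then have "(Y \<otimes>\<^bsub>LX\<^esub> Y) \<otimes>\<^bsub>LX\<^esub> Y [^]\<^bsub>LX\<^esub> m \<ominus>\<^bsub>LX\<^esub> Y = (Y \<otimes>\<^bsub>LX\<^esub> Y) \<otimes>\<^bsub>LX\<^esub> r"
    using f r(2) sq by simp
  moreover have "Y = Y \<otimes>\<^bsub>LX\<^esub> (Y \<otimes>\<^bsub>LX\<^esub> (w \<ominus>\<^bsub>LX\<^esub> r))"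
    if "w \<in> carrier LX" "(Y \<otimes>\<^bsub>LX\<^esub> Y) \<otimes>\<^bsub>LX\<^esub> w \<ominus>\<^bsub>LX\<^esub> Y = (Y \<otimes>\<^bsub>LX\<^esub> Y) \<otimes>\<^bsub>LX\<^esub> r" for w
  proof -
    have "Y = (Y \<otimes>\<^bsub>LX\<^esub> Y) \<otimes>\<^bsub>LX\<^esub> w \<ominus>\<^bsub>LX\<^esub> ((Y \<otimes>\<^bsub>LX\<^esub> Y) \<otimes>\<^bsub>LX\<^esub> w \<ominus>\<^bsub>LX\<^esub> Y)"
      using Y that(1) by algebra
    also have "\<dots> = (Y \<otimes>\<^bsub>LX\<^esub> Y) \<otimes>\<^bsub>LX\<^esub> w \<ominus>\<^bsub>LX\<^esub> (Y \<otimes>\<^bsub>LX\<^esub> Y) \<otimes>\<^bsub>LX\<^esub> r"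
      unfolding that(2) ..
    also have "\<dots> = Y \<otimes>\<^bsub>LX\<^esub> (Y \<otimes>\<^bsub>LX\<^esub> (w \<ominus>\<^bsub>LX\<^esub> r))"
      using Y r(1) that(1) by algebra
    finally show ?thesis .
  qed
  ultimately have "Y = Y \<otimes>\<^bsub>LX\<^esub> (Y \<otimes>\<^bsub>LX\<^esub> s)"
    unfolding s_def using Y by simp
  moreover have "eval Y a = \<zero>" unfolding Y_eq[symmetric] using a by (simp add: r_neg)
  moreover have "Y \<noteq> \<zero>\<^bsub>LX\<^esub>" unfolding Y_eq[symmetric] by (simp add: univ_poly_zero)
  ultimately have "\<one>\<^bsub>LX\<^esub> = Y \<otimes>\<^bsub>LX\<^esub> s"
    using UP.m_lcancel[of Y "\<one>\<^bsub>LX\<^esub>" "Y \<otimes>\<^bsub>LX\<^esub> s"] Y s by simp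
  interpret ev: ring_hom_cring LX L "\<lambda>f. eval f a"
    by (rule eval_cring_hom[OF carrier_is_subring a(1)])
  have "\<one> = eval (Y \<otimes>\<^bsub>LX\<^esub> s) a"
    using ev.hom_one \<open>\<one>\<^bsub>LX\<^esub> = Y \<otimes>\<^bsub>LX\<^esub> s\<close> by simp
  also have "\<dots> = \<zero>"
    using Y s \<open>eval Y a = \<zero>\<close> by simp
  finally show False by simp
qed

text \<open>Over the algebraically closed \<open>L\<close> the polynomial splits, so its multiset of
  roots has size \<open>q\<close>; no root is repeated by
  \<open>alg_mult_fermat_poly\<close>.\<close>

lemma card_frobenius_fixed: "card {a \<in> carrier L. a [^] q = a} = q"
proof -
  have "count (roots fermat_poly) a \<le> 1" for a
    using alg_mult_fermat_poly[of a] alg_mult_eq_count_roots[OF fermat_poly_closed] by simp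
  then have "roots fermat_poly = mset_set (set_mset (roots fermat_poly))"
    by (intro multiset_eqI) (metis count_greater_eq_one_iff count_mset_set(1,3) finite_set_mset le_antisym not_in_iff)
  then have "card (set_mset (roots fermat_poly)) = size (roots fermat_poly)"
    by (metis size_mset_set)
  moreover have "set_mset (roots fermat_poly) = {a \<in> carrier L. a [^] q = a}"
    using roots_mem_iff_is_root[OF fermat_poly_closed] is_root_fermat_poly by blast
  moreover have "size (roots fermat_poly) = q"
    using roots_over_carrier[OF fermat_poly_closed] degree_fermat_poly by (simp add: splitted_def)
  ultimately show ?thesis by simp
qed

lemma subfield_frobenius_fixed: "subfield {a \<in> carrier L. a [^] q = a} L" (is "subfield ?K L")
proof (rule subfieldI')
  have q0: "q \<noteq> 0" using q_ge_2 by linarith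
  show "subring ?K L"
  proof (rule subringI)
    \<comment> \<open>Additivity applied to \<open>\<ominus> a\<close> and \<open>a\<close> avoids
      the sign \<open>(-1)^q\<close> and treats \<open>p = 2\<close> uniformly.\<close>
    fix a assume a: "a \<in> ?K"
    have "(\<ominus> a) [^] q \<oplus> a [^] q = \<zero>"
      using frobenius_pow_add[OF p, of "\<ominus> a" a k] a q0 by (simp add: l_neg nat_pow_zero)
    then show "\<ominus> a \<in> ?K" using a by (simp add: minus_equality[symmetric])
  next
    fix a b assume "a \<in> ?K" "b \<in> ?K"
    then show "a \<otimes> b \<in> ?K" "a \<oplus> b \<in> ?K"
      using frobenius_pow_add[OF p] by (auto simp: nat_pow_distrib)
  qed auto
  fix a assume a: "a \<in> ?K - {\<zero>}"
  then have u: "a \<in> Units L" using field_Units by simp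
  have "a \<otimes> (inv a) [^] q = a \<otimes> inv a"
    using nat_pow_distrib[of a "inv a" q] a u by simp
  then have "(inv a) [^] q = inv a" 
    using Units_l_cancel[of a "(inv a) [^] q" "inv a"] u by (simp del: Units_r_inv)
  then show "inv a \<in> ?K" using u by simp
qed

end

text \<open>The field is the set of fixed points of the \<open>n\<close>-th power map in an
  algebraic closure of the integers modulo \<open>p\<close>. The type of \<open>F\<close> is the one
  carried by that closure.\<close>

lemma exists_finite_field:
  assumes "primepow n"
  obtains F :: "((int list \<times> nat) multiset \<Rightarrow> int) ring"
  where "field F" "finite (carrier F)" "card (carrier F) = n"
proof -
  obtain p k where pk: "prime p" "0 < k" "n = p ^ k"
    using assms unfolding primepow_def by blast
  have "residues_prime p" using pk(1) by unfold_locales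
  then interpret P: residues_prime p "residue_ring (int p)" by simp
  define L where "L = P.alg_closure"
  interpret L: algebraic_closure L "P.indexed_const ` carrier (residue_ring (int p))"
    unfolding L_def by (rule P.alg_closureE(1))
  interpret hom: ring_hom_ring "residue_ring (int p)" L P.indexed_const
    using P.alg_closureE(2) by (intro ring_hom_ringI2 P.ring_axioms L.ring_axioms) (simp add: L_def)
  have "[m] \<cdot>\<^bsub>residue_ring (int p)\<^esub> \<one>\<^bsub>residue_ring (int p)\<^esub> = int m mod int p" for m
    by (induction m) (simp_all add: P.zero_cong P.res_add_eq P.res_one_eq mod_simps add.commute)
  then have char: "[p] \<cdot>\<^bsub>L\<^esub> \<one>\<^bsub>L\<^esub> = \<zero>\<^bsub>L\<^esub>"
    using hom.hom_add_pow_one[of p] hom.hom_zero by (simp add: P.zero_cong)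
  interpret L: algebraically_closed_prime_char L p k
    by unfold_locales (use pk(1,2) char in auto)
  let ?K = "{a \<in> carrier L. a [^]\<^bsub>L\<^esub> n = a}"
  show ?thesis
  proof
    show "field (L\<lparr>carrier := ?K\<rparr>)"
      using L.subfield_iff(2)[OF L.subfield_frobenius_fixed] pk(3) by simp
    show "card (carrier (L\<lparr>carrier := ?K\<rparr>)) = n" using L.card_frobenius_fixed pk(3) by simp
    then show "finite (carrier (L\<lparr>carrier := ?K\<rparr>))"
      using primepow_gt_0_nat[OF assms] by (intro card_ge_0_finite) simp
  qed
qed

section \<open>Jacobsthal matrices from the quadratic character\<close>

context field
begin

text \<open>The multiplicative group of a finite field is cyclic, and a generator has order one less
  than the size of the field.\<close>

lemma finite_field_discrete_log:
  assumes fin: "finite (carrier R)"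
  obtains g where "g \<in> carrier R - {\<zero>}"
    "\<And>x. x \<in> carrier R - {\<zero>} \<Longrightarrow> \<exists>i :: nat. x = g [^] i"
    "\<And>i j :: nat. g [^] i = g [^] j \<longleftrightarrow> [i = j] (mod (card (carrier R) - 1))"
proof -
  let ?M = "Multiplicative_Group.mult_of R"
  from finite_field_mult_group_has_gen[OF fin]
  obtain g where g: "g \<in> carrier ?M" "carrier ?M = {g [^] i | i :: nat. i \<in> UNIV}" ..
  interpret G: group ?M by (rule field_mult_group)
  have finG: "finite (carrier ?M)" using fin by (rule finite_mult_of)
  have ord: "G.ord g = card (carrier R) - 1"
  proof -
    have "carrier ?M = generate ?M {g}"
      using G.generate_pow_nat[OF g(1)] g(2) finG G.ord_ge_1[OF finG g(1)]
      by (simp add: Multiplicative_Group.nat_pow_mult_of)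
    then have "G.ord g = order ?M"
      using G.generate_pow_card[OF g(1)] by (simp add: order_def)
    then show ?thesis using order_mult_of[OF fin] by (simp add: order_def)
  qed
  show ?thesis
  proof
    show "g \<in> carrier R - {\<zero>}" using g(1) by simp
    show "\<exists>i :: nat. x = g [^] i" if "x \<in> carrier R - {\<zero>}" for x using that g(2) by auto
    show "g [^] i = g [^] j \<longleftrightarrow> [i = j] (mod (card (carrier R) - 1))" for i j :: nat
    proof -
      have "g [^]\<^bsub>?M\<^esub> (int i) = g [^]\<^bsub>?M\<^esub> (int j) \<longleftrightarrow> [int i = int j] (mod int (G.ord g))"
        
        using G.int_pow_eq[OF g(1)] by (simp add: cong_iff_dvd_diff dvd_diff_commute)
      then show ?thesis
        unfolding ord int_pow_int cong_int_iff by (simp add: Multiplicative_Group.nat_pow_mult_of)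
    qed
  qed
qed

text \<open>The witness is the parity of the discrete logarithm.\<close>

lemma exists_quadratic_character:
  assumes fin: "finite (carrier R)" and odd: "odd (card (carrier R))"
  obtains \<chi> :: "'a \<Rightarrow> int" where
    "\<chi> \<zero> = 0"
    "\<And>x. x \<in> carrier R \<Longrightarrow> x \<noteq> \<zero> \<Longrightarrow> \<bar>\<chi> x\<bar> = 1"
    "\<And>x y. x \<in> carrier R \<Longrightarrow> y \<in> carrier R \<Longrightarrow> \<chi> (x \<otimes> y) = \<chi> x * \<chi> y"
    "\<chi> (\<ominus> \<one>) = (-1) ^ ((card (carrier R) - 1) div 2)"
    "\<exists>x \<in> carrier R. \<chi> x = -1"
proof -
  let ?n = "card (carrier R) - 1"
  obtain g where g: "g \<in> carrier R - {\<zero>}"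
    and log: "\<And>x. x \<in> carrier R - {\<zero>} \<Longrightarrow> \<exists>i :: nat. x = g [^] i"
    and g_eq: "\<And>i j :: nat. g [^] i = g [^] j \<longleftrightarrow> [i = j] (mod ?n)"
    using finite_field_discrete_log[OF fin] by blast
  \<comment> \<open>The value 0 at zero keeps \<open>\<chi>\<close> multiplicative on the whole
    field and later gives a matrix with zero diagonal.\<close>
  define \<chi> where "\<chi> x = (if x = \<zero> then 0 else (-1) ^ (SOME i :: nat. x = g [^] i) :: int)" for x
  have gc: "g \<in> carrier R" using g by simp
  have g0: "g [^] i \<noteq> \<zero>" for i :: nat
    by (induction i) (use g integral in auto)
  have n: "even ?n" "?n > 0"
  proof -
    show "even ?n" using odd by simp
    have "card {\<zero>, \<one>} \<le> card (carrier R)" by (rule card_mono[OF fin]) simp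
    then show "?n > 0" by simp
  qed
  \<comment> \<open>The choice of logarithm does not matter: two logarithms agree modulo
    \<open>?n\<close>, which is even, so they have the same parity.\<close>
  have \<chi>g: "\<chi> (g [^] i) = (-1) ^ i" for i :: nat
  proof -
    have "g [^] i = g [^] (SOME j :: nat. g [^] i = g [^] j)" by (rule someI) (rule refl)
    then have "[i = (SOME j :: nat. g [^] i = g [^] j)] (mod 2)"
      using g_eq n(1) cong_dvd_modulus_nat by blast
    then have "even i \<longleftrightarrow> even (SOME j :: nat. g [^] i = g [^] j)"
      by (rule cong_dvd_iff)
    then show ?thesis unfolding \<chi>_def using g0 by (simp add: minus_one_power_iff)
  qed
  show ?thesis
  proof
    show "\<chi> \<zero> = 0" by (simp add: \<chi>_def)
    show "\<bar>\<chi> x\<bar> = 1" if "x \<in> carrier R" "x \<noteq> \<zero>" for x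
      unfolding \<chi>_def using that by (simp add: power_abs)
    show "\<chi> (x \<otimes> y) = \<chi> x * \<chi> y" if xy: "x \<in> carrier R" "y \<in> carrier R" for x y
    proof (cases "x = \<zero> \<or> y = \<zero>")
      case True
      then show ?thesis using xy by (auto simp: \<chi>_def)
    next
      case False
      then obtain i j :: nat where "x = g [^] i" "y = g [^] j" using log xy by blast
      then show ?thesis using gc by (simp add: nat_pow_mult \<chi>g power_add)
    qed
    show "\<exists>x \<in> carrier R. \<chi> x = -1" using \<chi>g[of 1] gc by auto
    \<comment> \<open>The element \<open>g [^] m\<close> squares to 1 without being 1, so it is -1,
      and its logarithm \<open>m\<close> gives the sign.\<close>
    obtain m where m: "?n = 2 * m" using n(1) by (rule evenE)
    have "g [^] m \<noteq> \<one>"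
    proof
      assume "g [^] m = \<one>"
      then have "[m = 0] (mod 2 * m)" using g_eq[of m 0] unfolding m by simp
      then show False using n(2) m by (auto simp: cong_def)
    qed
    moreover have "g [^] m \<otimes> g [^] m = \<one>"
      using g_eq[of "m + m" 0] gc unfolding m
      by (simp add: nat_pow_mult cong_def flip: mult_2)
    ultimately have "g [^] m = \<ominus> \<one>"
      using square_eq_one[of "g [^] m"] gc by simp
    then show "\<chi> (\<ominus> \<one>) = (-1) ^ (?n div 2)" using \<chi>g[of m] m by simp
  qed
qed

text \<open>The matrix is \<open>\<chi> (x \<ominus> y)\<close>. Its row sums vanish because
  multiplication by an element \<open>u\<close> with \<open>\<chi> u = -1\<close> permutes the field
  and negates the sum of \<open>\<chi>\<close>.\<close>

lemma exists_jacobsthal: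
  assumes fin: "finite (carrier R)" and odd: "odd (card (carrier R))"
  shows "\<exists>P. jacobsthal (carrier R) P"
proof -
  obtain \<chi> :: "'a \<Rightarrow> int" where \<chi>_zero: "\<chi> \<zero> = 0"
    and \<chi>_abs: "\<And>x. x \<in> carrier R \<Longrightarrow> x \<noteq> \<zero> \<Longrightarrow> \<bar>\<chi> x\<bar> = 1"
    and \<chi>_mult: "\<And>x y. x \<in> carrier R \<Longrightarrow> y \<in> carrier R \<Longrightarrow> \<chi> (x \<otimes> y) = \<chi> x * \<chi> y"
    and \<chi>_minus_one: "\<chi> (\<ominus> \<one>) = (-1) ^ ((card (carrier R) - 1) div 2)"
    and "\<exists>x \<in> carrier R. \<chi> x = -1"
    by (rule exists_quadratic_character[OF fin odd]) (rule that)
  then obtain u where u: "u \<in> carrier R" "\<chi> u = -1" by blast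
  then have u0: "u \<noteq> \<zero>" using \<chi>_zero by auto
  have \<chi>_square: "\<chi> x * \<chi> x = 1" if "x \<in> carrier R" "x \<noteq> \<zero>" for x
    using \<chi>_abs[OF that] by (metis abs_mult_self_eq mult_1)
  have \<chi>_sum: "(\<Sum>x\<in>carrier R. \<chi> x) = 0"
  proof -
    have "bij_betw (\<lambda>x. u \<otimes> x) (carrier R) (carrier R)"
    proof (rule bij_betw_byWitness[of _ "\<lambda>x. inv u \<otimes> x"])
      have "u \<in> Units R" using u u0 field_Units by simp
      then show "\<forall>x\<in>carrier R. inv u \<otimes> (u \<otimes> x) = x" "\<forall>x\<in>carrier R. u \<otimes> (inv u \<otimes> x) = x"
        "(\<lambda>x. u \<otimes> x) ` carrier R \<subseteq> carrier R" "(\<lambda>x. inv u \<otimes> x) ` carrier R \<subseteq> carrier R"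
        using u(1) by (auto simp flip: m_assoc)
    qed
    then have "(\<Sum>x\<in>carrier R. \<chi> x) = (\<Sum>x\<in>carrier R. \<chi> (u \<otimes> x))"
      by (rule sum.reindex_bij_betw[symmetric])
    also have "\<dots> = - (\<Sum>x\<in>carrier R. \<chi> x)"
      using u by (simp add: \<chi>_mult sum_negf)
    finally show ?thesis by simp
  qed
  have bij_minus: "bij_betw (\<lambda>z. x \<ominus> z) (carrier R) (carrier R)" if x: "x \<in> carrier R" for x
  proof (rule bij_betw_byWitness[of _ "\<lambda>z. x \<ominus> z"])
    have "x \<ominus> (x \<ominus> z) = z" if "z \<in> carrier R" for z using x that by algebra
    then show "\<forall>z\<in>carrier R. x \<ominus> (x \<ominus> z) = z" "\<forall>z\<in>carrier R. x \<ominus> (x \<ominus> z) = z" by auto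
  qed (use x in auto)
  have "jacobsthal (carrier R) (\<lambda>x y. \<chi> (x \<ominus> y))"
    unfolding jacobsthal_def
  proof (intro conjI ballI impI)
    show "finite (carrier R)" by (rule fin)
    show "\<chi> (x \<ominus> x) = 0" if "x \<in> carrier R" for x using that \<chi>_zero by (simp add: a_minus_def r_neg)
    show "\<bar>\<chi> (x \<ominus> y)\<bar> = 1" if "x \<in> carrier R" "y \<in> carrier R" "x \<noteq> y" for x y
      using that \<chi>_abs by simp
    show "\<chi> (y \<ominus> x) = (-1) ^ ((card (carrier R) - 1) div 2) * \<chi> (x \<ominus> y)"
      if "x \<in> carrier R" "y \<in> carrier R" for x y
    proof -
      have "y \<ominus> x = \<ominus> \<one> \<otimes> (x \<ominus> y)" using that by algebra
      then show ?thesis using that \<chi>_mult[of "\<ominus> \<one>" "x \<ominus> y"] \<chi>_minus_one by simp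
    qed
    show "(\<Sum>z\<in>carrier R. \<chi> (x \<ominus> z)) = 0" if "x \<in> carrier R" for x
      using sum.reindex_bij_betw[OF bij_minus[OF that], of \<chi>] \<chi>_sum by simp
    show "(\<Sum>z\<in>carrier R. \<chi> (x \<ominus> z) * \<chi> (y \<ominus> z)) = -1"
      if x: "x \<in> carrier R" and y: "y \<in> carrier R" and xy: "x \<noteq> y" for x y
    proof -
      define d where "d = y \<ominus> x"
      have d: "d \<in> carrier R" "d \<noteq> \<zero>" unfolding d_def using x y xy by simp_all
      have "(\<Sum>z\<in>carrier R. \<chi> (x \<ominus> z) * \<chi> (y \<ominus> z))
        = (\<Sum>z\<in>carrier R. \<chi> (x \<ominus> z) * \<chi> (x \<ominus> z \<oplus> d))"
      proof (intro sum.cong refl)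
        fix z assume "z \<in> carrier R"
        then have "y \<ominus> z = x \<ominus> z \<oplus> d" unfolding d_def using x y by algebra
        then show "\<chi> (x \<ominus> z) * \<chi> (y \<ominus> z) = \<chi> (x \<ominus> z) * \<chi> (x \<ominus> z \<oplus> d)" by simp
      qed
      also have "\<dots> = (\<Sum>z\<in>carrier R. \<chi> z * \<chi> (z \<oplus> d))"
        by (rule sum.reindex_bij_betw[OF bij_minus[OF x]])
      also have "\<dots> = (\<Sum>z\<in>carrier R - {\<zero>}. \<chi> z * \<chi> (z \<oplus> d))"
        using fin by (subst sum.remove[of _ \<zero>]) (auto simp: \<chi>_zero)
      \<comment> \<open>Write \<open>z + d = z (1 + d/z)\<close>; the factor \<open>\<chi> z\<close>
        then occurs squared and equals 1 since \<open>z\<close> is nonzero.\<close>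
      also have "\<dots> = (\<Sum>z\<in>carrier R - {\<zero>}. \<chi> (\<one> \<oplus> inv z \<otimes> d))"
      proof (intro sum.cong refl)
        fix z assume z: "z \<in> carrier R - {\<zero>}"
        then have zU: "z \<in> Units R" using field_Units by simp
        then have iz: "inv z \<in> carrier R" by simp
        have "z \<otimes> (\<one> \<oplus> inv z \<otimes> d) = z \<oplus> (z \<otimes> inv z) \<otimes> d"
          using z d iz by (simp add: r_distr m_assoc)
        then have "z \<oplus> d = z \<otimes> (\<one> \<oplus> inv z \<otimes> d)" using zU d by simp
        then have *: "\<chi> z * \<chi> (z \<oplus> d) = (\<chi> z * \<chi> z) * \<chi> (\<one> \<oplus> inv z \<otimes> d)"
          using z d iz by (simp add: \<chi>_mult)
        have "\<chi> z * \<chi> z = 1" using \<chi>_square z by simp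
        then show "\<chi> z * \<chi> (z \<oplus> d) = \<chi> (\<one> \<oplus> inv z \<otimes> d)"
          unfolding * by (simp only: mult_1)
      qed
      also have "\<dots> = (\<Sum>z\<in>carrier R - {\<zero>}. \<chi> (\<one> \<oplus> z \<otimes> d))"
      proof (rule sum.reindex_bij_betw)
        show "bij_betw (\<lambda>z. inv z) (carrier R - {\<zero>}) (carrier R - {\<zero>})"
          unfolding field_Units[symmetric] by (rule bij_betw_byWitness[of _ "\<lambda>z. inv z"]) auto
      qed
      \<comment> \<open>As \<open>d\<close> is nonzero, \<open>1 + z d\<close> is an affine
        permutation of the field; omitting \<open>z = 0\<close> omits exactly the value 1. The full
        sum is 0, so \<open>- \<chi> \<one>\<close> remains.\<close>
      also have "\<dots> = (\<Sum>w\<in>carrier R - {\<one>}. \<chi> w)"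
      proof (rule sum.reindex_bij_betw)
        have dU: "d \<in> Units R" "inv d \<in> carrier R" using d field_Units by simp_all
        have inverse_left: "(\<one> \<oplus> z \<otimes> d \<ominus> \<one>) \<otimes> inv d = z" if "z \<in> carrier R" for z
        proof -
          have "\<one> \<oplus> z \<otimes> d \<ominus> \<one> = z \<otimes> d" using that d by algebra
          then show ?thesis using that d dU by (simp add: m_assoc)
        qed
        have inverse_right: "\<one> \<oplus> (w \<ominus> \<one>) \<otimes> inv d \<otimes> d = w" if "w \<in> carrier R" for w
        proof -
          have "(w \<ominus> \<one>) \<otimes> inv d \<otimes> d = w \<ominus> \<one>" using that d dU by (simp add: m_assoc)
          moreover have "\<one> \<oplus> (w \<ominus> \<one>) = w" using that by algebra
          ultimately show ?thesis by simp
        qed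
        show "bij_betw (\<lambda>z. \<one> \<oplus> z \<otimes> d) (carrier R - {\<zero>}) (carrier R - {\<one>})"
        proof (rule bij_betw_byWitness[of _ "\<lambda>w. (w \<ominus> \<one>) \<otimes> inv d"])
          show "\<forall>z\<in>carrier R - {\<zero>}. (\<one> \<oplus> z \<otimes> d \<ominus> \<one>) \<otimes> inv d = z"
            using inverse_left by blast
          show "\<forall>w\<in>carrier R - {\<one>}. \<one> \<oplus> (w \<ominus> \<one>) \<otimes> inv d \<otimes> d = w"
            using inverse_right by blast
          have "\<one> \<oplus> z \<otimes> d \<noteq> \<one>" if "z \<in> carrier R" "z \<noteq> \<zero>" for z
            using inverse_left[OF that(1)] that(2) dU by (auto simp: a_minus_def r_neg)
          then show "(\<lambda>z. \<one> \<oplus> z \<otimes> d) ` (carrier R - {\<zero>}) \<subseteq> carrier R - {\<one>}"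
            using d by auto
          have "(w \<ominus> \<one>) \<otimes> inv d \<noteq> \<zero>" if "w \<in> carrier R" "w \<noteq> \<one>" for w
            using inverse_right[OF that(1)] that(2) d by auto
          then show "(\<lambda>w. (w \<ominus> \<one>) \<otimes> inv d) ` (carrier R - {\<one>}) \<subseteq> carrier R - {\<zero>}"
            using dU by auto
        qed
      qed
      also have "\<dots> = - \<chi> \<one>"
        using fin \<chi>_sum by (simp add: sum_diff1)
      also have "\<chi> \<one> = 1"
        using \<chi>_mult[of \<one> \<one>] \<chi>_abs[of \<one>] by auto
      finally show ?thesis .
    qed
  qed
  then show ?thesis by blast
qed

end

section \<open>Parity of twin prime powers and assembly\<close>

lemma exists_jacobsthal_primepow:
  assumes "primepow (n :: nat)" "odd n"
  shows "\<exists>P. jacobsthal {..<n} P"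
proof -
  obtain F :: "((int list \<times> nat) multiset \<Rightarrow> int) ring"
    where F: "field F" "finite (carrier F)" "card (carrier F) = n"
    using exists_finite_field[OF assms(1)] by blast
  obtain P where P: "jacobsthal (carrier F) P"
    using field.exists_jacobsthal[OF F(1,2)] F(3) assms(2) by blast
  obtain f where "bij_betw f {..<n} (carrier F)"
    using ex_bij_betw_nat_finite[OF F(2)] F(3) by (auto simp: atLeast0LessThan)
  then show ?thesis using jacobsthal_bij_betw[OF P] by blast
qed

text \<open>The prime must be 2, and exceeding 2 forces its exponent to be at least 2. This serves
  to exclude even \<open>l\<close>: two multiples of 4 cannot differ by 2.\<close>

lemma four_dvd_even_primepow:
  assumes "primepow (n :: nat)" "even n" "2 < n"
  shows "4 dvd n"
proof -
  obtain p k where pk: "prime p" "n = p ^ k"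
    using assms(1) unfolding primepow_def by blast
  then have "2 dvd p" using assms(2) by (metis prime_dvd_power two_is_prime_nat)
  then have p: "p = 2" using pk(1) primes_dvd_imp_eq two_is_prime_nat by blast
  have "2 \<le> k"
  proof (rule ccontr)
    assume "\<not> 2 \<le> k"
    then have "k = 0 \<or> k = 1" by linarith
    then show False using assms(3) pk(2) p by auto
  qed
  then have "2 ^ 2 dvd (2 :: nat) ^ k" by (rule le_imp_power_dvd)
  then show ?thesis using pk(2) p by simp
qed

theorem theorem6p4:
  fixes l :: nat
  assumes "l \<ge> 5" and "primepow l" and "primepow (l - 2)"
  shows "\<exists>(V :: nat set) (\<B> :: nat set multiset) (C :: nat set) (c :: nat \<Rightarrow> nat).
           is_BIBD V \<B> (l * (l - 2)) ((l - 1)\<^sup>2 div 2) ((l - 1)\<^sup>2 div 4) \<and>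
           is_0_ULSE_colouring V \<B> ((l - 1)\<^sup>2 div 2) l C c"
proof -
  have odd: "odd l"
  proof
    assume "even l"
    then have "4 dvd l" "4 dvd l - 2"
      using assms by (auto intro!: four_dvd_even_primepow)
    then have "4 dvd l - (l - 2)" by (rule dvd_diff_nat)
    then show False using assms(1) by simp
  qed
  then have "odd (l - 2)" using assms(1) by simp
  then obtain P Q where "jacobsthal {..<l - 2} P" "jacobsthal {..<l} Q"
    using exists_jacobsthal_primepow assms(2,3) odd by blast
  then have "twin_jacobsthal {..<l - 2} {..<l} P Q"
    using assms(1) \<open>odd (l - 2)\<close> by unfold_locales simp_all
  then show ?thesis by (rule twin_jacobsthal_design[OF _ card_lessThan assms(1)])
qed

end
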